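(* Let $\mathbf p=\mathcal{P}(\mathbf c)\in\mathbb{R}^n$ be a vector of logit path choice probabilities, and let $\mathcal{H}'_{\mathbf h}(\mathbf p)\in\mathbb{R}^{n\times n}$ be the Jacobian with respect to $\mathbf h$ (with $\mathbf p$ held fixed) of the target path flow mapping $\mathcal{H}(\mathbf h,\mathbf p)$. The product of $\mathcal{H}'_{\mathbf h}(\mathbf p)$ with the difference of any two feasible path flow vectors is zero: for any two feasible path flow vectors $\mathbf h^1,\mathbf h^2\in\mathbb{R}^n$, $$\mathcal{H}'_{\mathbf h}(\mathbf p)\,(\mathbf h^1-\mathbf h^2)=\mathbf 0.$$
   Context: There is a finite nonempty set of origin-destination (OD) pairs. Each OD pair has a demand $d_{OD}\ge 0$ and a fixed finite nonempty set $\mathbb{P}_{OD}$ of paths; $\mathbb{P}$ is the disjoint union of the $\mathbb{P}_{OD}$, $n=|\mathbb{P}|$, and $OD(i)$ is the OD pair of path $i$. A vector $\mathbf{h}\in\mathbb{R}^n$ is a feasible path flow vector if $h_i\ge 0$ for all $i$ and $\sum_{i\in\mathbb{P}_{OD}}h_i=d_{OD}$ for every OD pair. With a parameter $\theta>0$, the logit probabilities for a path cost vector $\mathbf c\in\mathbb{R}^n$ are $\mathcal{P}(\mathbf c)_i=\exp(-\theta c_i)/\sum_{i'\in\mathbb{P}_{OD(i)}}\exp(-\theta c_{i'})$. The target path flow mapping is $\mathcal{H}(\mathbf h,\mathbf p)_i=\bigl(\sum_{i'\in\mathbb{P}_{OD(i)}}h_{i'}\bigr)p_i$ for $i\in\mathbb{P}$.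 *)

theory Defs
  imports "HOL-Analysis.Analysis"
begin

text \<open>
  The OD pairs are the elements of a finite type \<open>'w\<close> and the paths the elements of a finite
  type \<open>'i\<close>, so that \<open>real ^ 'i\<close> is \<open>\<real>\<^sup>n\<close> with \<open>n\<close> the number of
  paths. The map \<open>od\<close> sends each path to its OD pair; the path sets of the OD pairs are its
  fibres, which are automatically disjoint and cover all paths. They are all nonempty exactly
  when \<open>od\<close> is surjective.
\<close>

definition paths :: "('i \<Rightarrow> 'w) \<Rightarrow> 'w \<Rightarrow> 'i set" where
  "paths od w = {i. od i = w}"

definition feasible_flow ::
  "('i::finite \<Rightarrow> 'w::finite) \<Rightarrow> ('w \<Rightarrow> real) \<Rightarrow> real ^ 'i \<Rightarrow> bool" where
  "feasible_flow od d h \<longleftrightarrow>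
     (\<forall>i. h $ i \<ge> 0) \<and> (\<forall>w. (\<Sum>i\<in>paths od w. h $ i) = d w)"

definition logit ::
  "('i::finite \<Rightarrow> 'w::finite) \<Rightarrow> real \<Rightarrow> real ^ 'i \<Rightarrow> real ^ 'i" where
  "logit od \<theta> c =
     (\<chi> i. exp (- \<theta> * c $ i) / (\<Sum>j\<in>paths od (od i). exp (- \<theta> * c $ j)))"

definition target_flow ::
  "('i::finite \<Rightarrow> 'w::finite) \<Rightarrow> real ^ 'i \<Rightarrow> real ^ 'i \<Rightarrow> real ^ 'i" where
  "target_flow od h p = (\<chi> i. (\<Sum>j\<in>paths od (od i). h $ j) * p $ i)"

text \<open>
  The library's \<open>jacobian\<close> is meaningful only where the function is differentiable;
  the target path flow mapping is differentiable in \<open>h\<close> everywhere.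
\<close>

lemma target_flow_differentiable:
  "(\<lambda>h. target_flow od h p) differentiable (at h0)"
proof -
  have "linear (\<lambda>h. target_flow od h p)"
    by (rule linearI)
      (simp_all add: target_flow_def vec_eq_iff sum.distrib sum_distrib_left algebra_simps)
  then show ?thesis
    by (simp add: linear_imp_differentiable)
qed

end

theory Submission
  imports Defs
begin

text \<open>For fixed \<open>p\<close>, \<open>target_flow\<close> is linear in the flow
  (\<open>linear_target_flow\<close>), so applying its Jacobian to a vector just evaluates the
  mapping there (\<open>jacobian_linear\<close>). The mapping sees a flow only through its OD
  totals, and feasible flows share these totals, so their difference is sent to zero.\<close>

lemma linear_target_flow: "linear (\<lambda>h. target_flow od h p)"
  by (rule linearI)
    (simp_all add: target_flow_def vec_eq_iff sum.distrib sum_distrib_left algebra_simps)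

text \<open>A linear map is its own derivative everywhere, so its Jacobian is its matrix, whatever
  the base point.\<close>

lemma jacobian_linear:
  fixes f :: "real ^ 'n \<Rightarrow> real ^ 'm"
  assumes "linear f"
  shows "jacobian f (at x) *v v = f v"
proof -
  have "(f has_derivative f) (at x)"
    using assms by (simp add: linear_imp_has_derivative)
  then have "jacobian f (at x) = matrix f"
    by (simp add: jacobian_def frechet_derivative_at[symmetric])
  then show ?thesis
    using assms by (simp add: matrix_works)
qed

theorem lemma1:
  fixes od :: "'i::finite \<Rightarrow> 'w::finite"
    and d :: "'w \<Rightarrow> real"
    and \<theta> :: real
    and c p h0 h1 h2 :: "real ^ 'i"
  assumes "surj od"
    and "\<And>w. d w \<ge> 0"
    and "\<theta> > 0"
    and "p = logit od \<theta> c"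
    and "feasible_flow od d h1"
    and "feasible_flow od d h2"
  shows "jacobian (\<lambda>h. target_flow od h p) (at h0) *v (h1 - h2) = 0"
proof -
  \<comment> \<open>Both flows have total \<open>d w\<close> on the OD pair
    \<open>w\<close>.\<close>
  have "(\<Sum>j\<in>paths od w. (h1 - h2) $ j) = 0" for w
    using assms(5,6) by (simp add: feasible_flow_def sum_subtractf)
  \<comment> \<open>Component \<open>i\<close> has the total at \<open>w = od i\<close> as a
    factor.\<close>
  then have "target_flow od (h1 - h2) p = 0"
    by (simp only: target_flow_def) (simp add: vec_eq_iff)
  then show ?thesis
    by (simp add: jacobian_linear[OF linear_target_flow])
qed

end
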